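(* For every composition $\eta$, the bar monomial $x^{\underline\eta}$ is the unique polynomial $g$ such that (1) $g-x^\eta$ has degree $<|\eta|$, and (2) $g(-\overline\gamma)=0$ for all compositions $\gamma$ with $|\gamma|<|\eta|$.
   Context: Fix $n\ge1$; $r$ is an indeterminate, $\alpha=1/r$, $\mathbb{F}=\mathbb{Q}(r)$, polynomials in $\mathbb{F}[x_1,\dots,x_n]$. Compositions are $\eta\in\mathbb{N}^n$, $|\eta|=\sum\eta_i$, $x^\eta=\prod x_i^{\eta_i}$; partitions are weakly decreasing compositions; $\delta=(n-1,\dots,0)$; permutations act on vectors by $(wv)_{w(i)}=v_i$; $w_\gamma$ is the minimal-length permutation with $w_\gamma^{-1}(\gamma)$ a partition, $\overline\gamma=\gamma+w_\gamma(r\delta)$. $E_\eta^{r\delta}$ is the unique polynomial of degree $|\eta|$ vanishing at all $\overline\gamma$ with $\gamma\ne\eta$, $|\gamma|\le|\eta|$, with coefficient $1$ on $x^\eta$; $E_\eta^{(\alpha)}$ its top homogeneous component. With $a_\eta(i,j)=\eta_i-j$, $l_\eta(i,j)=\#\{k>i:j\le\eta_k\le\eta_i\}+\#\{k<i:j\le\eta_k+1\le\eta_i\}$, $d_\eta(\alpha)=\prod_{1\le j\le\eta_i}(\alpha(a_\eta(i,j)+1)+l_\eta(i,j)+1)$, set $F_\eta^{(\alpha)}=d_\eta E_\eta^{(\alpha)}$, $F_\eta^{r\delta}(x)=(-1)^{|\eta|}d_\eta E_\eta^{r\delta}(-x)$; $\Xi$ is the unique $\mathbb{F}$-linear operator with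 $\Xi(F_\eta^{(\alpha)})=F_\eta^{r\delta}$; the bar monomial is $x^{\underline\eta}=\Xi(x^\eta)$. *)

theory Defs
  imports
    "HOL-Library.Poly_Mapping"
    "HOL-Computational_Algebra.Fraction_Field"
    "HOL-Computational_Algebra.Polynomial"
begin

text \<open>
  The index set $\{1,\dots,n\}$ is an arbitrary finite linearly ordered type \<open>'n\<close>
  (so $n =$ \<open>CARD('n)\<close>, which is automatically at least $1$).
  The field $\mathbb{Q}(r)$ is the fraction field of \<open>rat poly\<close>.
  A composition is used both as a vector and as the exponent of a monomial, so a polynomial
  in the variables $x_i$ is a finitely supported map from compositions to coefficients,
  with the convolution product of the library.
\<close>

type_synonym ratfun = "rat poly fract"
type_synonym 'n composition = "'n \<Rightarrow>\<^sub>0 nat"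
type_synonym 'n mpolynomial = "'n composition \<Rightarrow>\<^sub>0 ratfun"

abbreviation lookup :: "('a \<Rightarrow>\<^sub>0 'b::zero) \<Rightarrow> 'a \<Rightarrow> 'b" where
  "lookup \<equiv> Poly_Mapping.lookup"

abbreviation keys :: "('a \<Rightarrow>\<^sub>0 'b::zero) \<Rightarrow> 'a set" where
  "keys \<equiv> Poly_Mapping.keys"

definition r_ind :: ratfun where
  "r_ind = Fraction_Field.Fract [:0, 1:] 1"

definition alpha :: ratfun where
  "alpha = 1 / r_ind"

definition csize :: "('n::finite) composition \<Rightarrow> nat" where
  "csize \<eta> = (\<Sum>i\<in>UNIV. lookup \<eta> i)"


subsection \<open>Polynomials\<close>

definition monomial :: "'n composition \<Rightarrow> 'n mpolynomial" where
  "monomial \<eta> = Poly_Mapping.single \<eta> 1"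

definition var_poly :: "'n \<Rightarrow> 'n mpolynomial" where
  "var_poly i = monomial (Poly_Mapping.single i 1)"

definition const_poly :: "ratfun \<Rightarrow> 'n mpolynomial" where
  "const_poly c = Poly_Mapping.single 0 c"

definition pscale :: "ratfun \<Rightarrow> 'n mpolynomial \<Rightarrow> 'n mpolynomial" where
  "pscale c p = const_poly c * p"

definition peval :: "('n::finite) mpolynomial \<Rightarrow> ('n \<Rightarrow> ratfun) \<Rightarrow> ratfun" where
  "peval p v = (\<Sum>m\<in>keys p. lookup p m * (\<Prod>i\<in>UNIV. v i ^ lookup m i))"

text \<open>The substitution $p(x) \mapsto p(-x)$.\<close>

definition subst_neg :: "('n::finite) mpolynomial \<Rightarrow> 'n mpolynomial" where
  "subst_neg p = (\<Sum>m\<in>keys p. const_poly (lookup p m) * (\<Prod>i\<in>UNIV. (- var_poly i) ^ lookup m i))"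

text \<open>
  Total degree. The zero polynomial gets degree $-1$ (in place of $-\infty$), so that
  a polynomial of degree less than $0$ is zero.
\<close>

definition tdegree :: "('n::finite) mpolynomial \<Rightarrow> int" where
  "tdegree p = (if p = 0 then - 1 else int (Max (csize ` keys p)))"

definition top_component :: "('n::finite) mpolynomial \<Rightarrow> 'n mpolynomial" where
  "top_component p =
     (\<Sum>m \<in> {m \<in> keys p. int (csize m) = tdegree p}. Poly_Mapping.single m (lookup p m))"


subsection \<open>The interpolation points\<close>

text \<open>$(wv)_{w(i)} = v_i$\<close>

definition perm_act :: "('n \<Rightarrow> 'n) \<Rightarrow> ('n \<Rightarrow> 'a) \<Rightarrow> ('n \<Rightarrow> 'a)" where
  "perm_act w v = (\<lambda>i. v (inv w i))"

definition perm_length :: "('n::{finite,linorder} \<Rightarrow> 'n) \<Rightarrow> nat" where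
  "perm_length w = card {(i, j). i < j \<and> w j < w i}"

definition w_min :: "('n::{finite,linorder}) composition \<Rightarrow> 'n \<Rightarrow> 'n" where
  "w_min \<gamma> =
     (ARG_MIN perm_length w. bij w \<and> antimono (perm_act (inv w) (lookup \<gamma>)))"

text \<open>$\delta = (n-1, \dots, 1, 0)$\<close>

definition delta :: "'n::{finite,linorder} \<Rightarrow> nat" where
  "delta i = card {k. i < k}"

definition bar :: "('n::{finite,linorder}) composition \<Rightarrow> 'n \<Rightarrow> ratfun" where
  "bar \<gamma> = (\<lambda>i. of_nat (lookup \<gamma> i) + perm_act (w_min \<gamma>) (\<lambda>k. r_ind * of_nat (delta k)) i)"


subsection \<open>Interpolation polynomials and nonsymmetric Jack polynomials\<close>

definition E_interp :: "('n::{finite,linorder}) composition \<Rightarrow> 'n mpolynomial" where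
  "E_interp \<eta> = (THE p.
     tdegree p = int (csize \<eta>) \<and>
     (\<forall>\<gamma>. \<gamma> \<noteq> \<eta> \<and> csize \<gamma> \<le> csize \<eta> \<longrightarrow> peval p (bar \<gamma>) = 0) \<and>
     lookup p \<eta> = 1)"

definition E_jack :: "('n::{finite,linorder}) composition \<Rightarrow> 'n mpolynomial" where
  "E_jack \<eta> = top_component (E_interp \<eta>)"

text \<open>The truncated subtraction is harmless: the arm is only used for $1 \le j \le \eta_i$.\<close>

definition arm :: "'n composition \<Rightarrow> 'n \<Rightarrow> nat \<Rightarrow> nat" where
  "arm \<eta> i j = lookup \<eta> i - j"

definition leg :: "('n::{finite,linorder}) composition \<Rightarrow> 'n \<Rightarrow> nat \<Rightarrow> nat" where
  "leg \<eta> i j =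
     card {k. k > i \<and> j \<le> lookup \<eta> k \<and> lookup \<eta> k \<le> lookup \<eta> i} +
     card {k. k < i \<and> j \<le> lookup \<eta> k + 1 \<and> lookup \<eta> k + 1 \<le> lookup \<eta> i}"

definition d_coeff :: "('n::{finite,linorder}) composition \<Rightarrow> ratfun" where
  "d_coeff \<eta> =
     (\<Prod>i\<in>UNIV. \<Prod>j\<in>{1..lookup \<eta> i}.
        alpha * (of_nat (arm \<eta> i j) + 1) + of_nat (leg \<eta> i j) + 1)"

definition F_jack :: "('n::{finite,linorder}) composition \<Rightarrow> 'n mpolynomial" where
  "F_jack \<eta> = pscale (d_coeff \<eta>) (E_jack \<eta>)"

definition F_interp :: "('n::{finite,linorder}) composition \<Rightarrow> 'n mpolynomial" where
  "F_interp \<eta> = pscale ((- 1) ^ csize \<eta> * d_coeff \<eta>) (subst_neg (E_interp \<eta>))"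


subsection \<open>Bar monomials\<close>

definition Xi :: "('n::{finite,linorder}) mpolynomial \<Rightarrow> 'n mpolynomial" where
  "Xi = (THE T. Vector_Spaces.linear pscale pscale T \<and> (\<forall>\<eta>. T (F_jack \<eta>) = F_interp \<eta>))"

definition bar_monomial :: "('n::{finite,linorder}) composition \<Rightarrow> 'n mpolynomial" where
  "bar_monomial \<eta> = Xi (monomial \<eta>)"

end

theory Submission
  imports Defs "HOL-Computational_Algebra.Polynomial_Factorial" "HOL-Library.FuncSet"
begin

text \<open>
  At $r = 0$ the interpolation points $\overline\gamma$ become the lattice points $\gamma$, and there
  the coefficient of $x^\eta$ in a polynomial of degree $\le |\eta|$ is a linear combination of its
  values at the $\gamma \le \eta$ (an iterated finite difference). Clearing denominators and common
  powers of $r$ therefore shows that a polynomial of degree $\le d$ over $\mathbb{Q}(r)$ vanishes as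
  soon as its values at all $\overline\gamma$ with $|\gamma| < d$ vanish and, for each $|\gamma| = d$,
  either its value at $\overline\gamma$ or its coefficient of $x^\gamma$ vanishes. Counting dimensions,
  such mixed data can also be prescribed arbitrarily. This gives the $E_\eta^{r\delta}$, and it lifts
  each homogeneous polynomial of degree $d$ to a unique polynomial with that top component vanishing
  at the $\overline\gamma$ with $|\gamma| < d$. The lift sends $E_\eta^{(\alpha)}$ to
  $E_\eta^{r\delta}$, and the $E_\eta^{(\alpha)}$ span, so up to the substitution $x \mapsto -x$ the
  lift is $\Xi$.
\<close>

subsection \<open>Interpolation at lattice points\<close>

text \<open>The weights of the \<open>k\<close>-th forward difference at 0 divided by
  \<open>k!\<close>: on polynomials of degree at most \<open>k\<close> this functional reads off the
  coefficient of the \<open>k\<close>-th power.\<close>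

lemma finite_difference_weights:
  "\<exists>w :: nat \<Rightarrow> 'a::field_char_0. \<forall>m\<le>k. (\<Sum>j\<le>k. w j * of_nat j ^ m) = (if m = k then 1 else 0)"
proof (induction k)
  case 0
  show ?case by (rule exI[of _ "\<lambda>_. 1"]) simp
next
  case (Suc k)
  then obtain w :: "nat \<Rightarrow> 'a"
    where w: "\<And>m. m \<le> k \<Longrightarrow> (\<Sum>j\<le>k. w j * of_nat j ^ m) = (if m = k then 1 else 0)"
    by auto
  \<comment> \<open>If \<open>w\<close> represents a functional \<open>L\<close>, these weights
    represent f \<mapsto> (L(f(x+1)) - L(f(x))) / (k+1): one more difference, normalized because
    differencing x^(k+1) gives leading coefficient k+1.\<close>
  define w' :: "nat \<Rightarrow> 'a" where
    "w' j = ((if j = 0 then 0 else w (j - 1)) - (if j \<le> k then w j else 0)) / of_nat (Suc k)" for j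
  have "(\<Sum>j\<le>Suc k. w' j * of_nat j ^ m) = (if m = Suc k then 1 else 0)" if m: "m \<le> Suc k" for m
  proof -
    have w': "of_nat (Suc k) * w' j = (if j = 0 then 0 else w (j - 1)) - (if j \<le> k then w j else 0)"
      for j
      by (simp add: w'_def del: of_nat_Suc)
    have "of_nat (Suc k) * (\<Sum>j\<le>Suc k. w' j * of_nat j ^ m)
        = (\<Sum>j\<le>Suc k. (if j = 0 then 0 else w (j - 1)) * of_nat j ^ m)
          - (\<Sum>j\<le>Suc k. (if j \<le> k then w j else 0) * of_nat j ^ m)"
      unfolding sum_distrib_left sum_subtractf[symmetric] mult.assoc[symmetric] w'
      by (simp only: left_diff_distrib)
    also have "(\<Sum>j\<le>Suc k. (if j = 0 then 0 else w (j - 1)) * of_nat j ^ m)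
        = (\<Sum>j\<le>k. w j * (of_nat j + 1) ^ m)"
      by (subst sum.atMost_Suc_shift) (simp add: add.commute)
    also have "(\<Sum>j\<le>Suc k. (if j \<le> k then w j else 0) * of_nat j ^ m) = (\<Sum>j\<le>k. w j * of_nat j ^ m)"
      by simp
    also have "(\<Sum>j\<le>k. w j * (of_nat j + 1) ^ m) - (\<Sum>j\<le>k. w j * of_nat j ^ m)
        = (\<Sum>j\<le>k. w j * (\<Sum>l<m. of_nat (m choose l) * of_nat j ^ l))"
    proof -
      have "(of_nat j + 1) ^ m = (\<Sum>l<m. of_nat (m choose l) * of_nat j ^ l) + (of_nat j ^ m :: 'a)" for j
        by (simp add: binomial_ring lessThan_Suc_atMost[symmetric])
      then show ?thesis
        by (simp add: sum_subtractf[symmetric] algebra_simps)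
    qed
    also have "\<dots> = (\<Sum>l<m. of_nat (m choose l) * (\<Sum>j\<le>k. w j * of_nat j ^ l))"
      unfolding sum_distrib_left by (subst sum.swap) (simp add: mult_ac)
    also have "\<dots> = (\<Sum>l<m. of_nat (m choose l) * (if l = k then 1 else 0))"
      by (rule sum.cong) (use m w in auto)
    \<comment> \<open>Since l < m \<le> k+1, the index l = k occurs only for m = k+1, and there the
      binomial coefficient is k+1.\<close>
    also have "\<dots> = of_nat (Suc k) * (if m = Suc k then 1 else 0)"
    proof (cases "m = Suc k")
      case True
      then show ?thesis by (simp del: of_nat_Suc)
    next
      case False
      then show ?thesis using m by (auto intro!: sum.neutral)
    qed
    finally show ?thesis by (simp del: of_nat_Suc)
  qed
  then show ?case by blast
qed

section \<open>Several variables: the box of lattice points below a composition\<close>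

lemma lookup_Abs_finite [simp]:
  "lookup (Abs_poly_mapping f) = f" for f :: "'n::finite \<Rightarrow> 'b::zero"
  by (rule lookup_Abs_poly_mapping) simp

lemma finite_csize_le [simp]: "finite {m :: 'n::finite composition. csize m \<le> d}"
proof -
  have "lookup ` {m :: 'n composition. csize m \<le> d} \<subseteq> (\<Pi>\<^sub>E i\<in>UNIV. {..d})"
  proof safe
    fix m :: "'n composition" and i
    assume "csize m \<le> d"
    moreover have "lookup m i \<le> csize m"
      unfolding csize_def by (rule member_le_sum) auto
    ultimately show "lookup m i \<le> d" by simp
  qed auto
  then have "finite (lookup ` {m :: 'n composition. csize m \<le> d})"
    by (rule finite_subset) (simp add: finite_PiE)
  then show ?thesis
    by (rule finite_imageD) (auto intro: inj_onI poly_mapping_eqI)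
qed

lemma csize_less_of_le:
  assumes "\<And>i. lookup \<gamma> i \<le> lookup \<eta> i" and "\<gamma> \<noteq> \<eta>"
  shows "csize \<gamma> < csize (\<eta> :: 'n::finite composition)"
proof -
  from assms(2) obtain i where "lookup \<gamma> i \<noteq> lookup \<eta> i"
    by (metis poly_mapping_eqI)
  with assms(1)[of i] have "lookup \<gamma> i < lookup \<eta> i" by simp
  then show ?thesis
    unfolding csize_def by (intro sum_strict_mono_ex1) (use assms(1) in auto)
qed

lemma exists_lookup_less:
  assumes "csize m \<le> csize \<eta>" and "m \<noteq> (\<eta> :: 'n::finite composition)"
  shows "\<exists>i. lookup m i < lookup \<eta> i"
proof (rule ccontr)
  assume "\<not> ?thesis"
  then have "csize \<eta> < csize m"
    using assms(2) by (intro csize_less_of_le) (auto simp: not_less)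
  with assms(1) show False by simp
qed

text \<open>Tensor product of the one-variable functionals, so its value on a monomial factors over
  the coordinates. A monomial other than x^\<eta> of no larger degree has some exponent below that
  of \<eta>, and that factor is 0.\<close>

lemma coeff_functional:
  fixes \<eta> :: "'n::finite composition"
  shows "\<exists>W :: ('n \<Rightarrow> nat) \<Rightarrow> 'a::field_char_0. \<forall>m :: 'n composition. csize m \<le> csize \<eta> \<longrightarrow>
    (\<Sum>g\<in>(\<Pi>\<^sub>E i\<in>UNIV. {..lookup \<eta> i}). W g * (\<Prod>i\<in>UNIV. of_nat (g i) ^ lookup m i))
      = (if m = \<eta> then 1 else 0)"
proof -
  obtain w :: "nat \<Rightarrow> nat \<Rightarrow> 'a"
    where w: "\<And>k m. m \<le> k \<Longrightarrow> (\<Sum>j\<le>k. w k j * of_nat j ^ m) = (if m = k then 1 else 0)"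
    using finite_difference_weights[where 'a = 'a] by metis
  define W :: "('n \<Rightarrow> nat) \<Rightarrow> 'a" where "W g = (\<Prod>i\<in>UNIV. w (lookup \<eta> i) (g i))" for g
  have "(\<Sum>g\<in>(\<Pi>\<^sub>E i\<in>UNIV. {..lookup \<eta> i}). W g * (\<Prod>i\<in>UNIV. of_nat (g i) ^ lookup m i))
      = (if m = \<eta> then 1 else 0)"
    if m: "csize m \<le> csize \<eta>" for m :: "'n composition"
  proof -
    have "(\<Sum>g\<in>(\<Pi>\<^sub>E i\<in>UNIV. {..lookup \<eta> i}). W g * (\<Prod>i\<in>UNIV. of_nat (g i) ^ lookup m i))
        = (\<Prod>i\<in>UNIV. \<Sum>j\<le>lookup \<eta> i. w (lookup \<eta> i) j * of_nat j ^ lookup m i)"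
      by (subst prod_sum_PiE) (simp_all add: W_def prod.distrib)
    also have "\<dots> = (if m = \<eta> then 1 else 0)"
    proof (cases "m = \<eta>")
      case True
      then show ?thesis by (simp add: w)
    next
      case False
      then obtain i where "lookup m i < lookup \<eta> i"
        using exists_lookup_less m by blast
      then have "(\<Sum>j\<le>lookup \<eta> i. w (lookup \<eta> i) j * of_nat j ^ lookup m i) = 0"
        by (simp add: w)
      then show ?thesis using False by (auto intro!: prod_zero)
    qed
    finally show ?thesis .
  qed
  then show ?thesis by blast
qed

text \<open>Apply the coefficient functional at an exponent \<eta> of maximal size in the support.
  It only uses values at lattice points of the box below \<eta>; these all vanish, which contradicts
  \<open>a \<eta> \<noteq> 0\<close>.\<close>

lemma lattice_unisolvent:
  fixes a :: "'n::finite composition \<Rightarrow> 'a::field_char_0"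
  assumes fin: "finite M" and deg: "\<And>m. m \<in> M \<Longrightarrow> csize m \<le> d"
    and low: "\<And>\<gamma> :: 'n composition. csize \<gamma> < d \<Longrightarrow>
        (\<Sum>m\<in>M. a m * (\<Prod>i\<in>UNIV. of_nat (lookup \<gamma> i) ^ lookup m i)) = 0"
    and top: "\<And>\<gamma> :: 'n composition. csize \<gamma> = d \<Longrightarrow> \<gamma> \<in> M \<Longrightarrow> a \<gamma> = 0 \<or>
        (\<Sum>m\<in>M. a m * (\<Prod>i\<in>UNIV. of_nat (lookup \<gamma> i) ^ lookup m i)) = 0"
    and m: "m \<in> M"
  shows "a m = 0"
proof (rule ccontr)
  assume "a m \<noteq> 0"
  define N where "N = {m \<in> M. a m \<noteq> 0}"
  have N: "finite N" "N \<noteq> {}" using fin m \<open>a m \<noteq> 0\<close> by (auto simp: N_def)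
  define e where "e = Max (csize ` N)"
  have "e \<in> csize ` N" unfolding e_def by (rule Max_in) (use N in auto)
  then obtain \<eta> where \<eta>: "\<eta> \<in> N" "csize \<eta> = e" by blast
  have le: "csize m \<le> csize \<eta>" if "m \<in> N" for m
    using that N \<eta> unfolding e_def by simp
  define v where "v \<gamma> = (\<Sum>m\<in>M. a m * (\<Prod>i\<in>UNIV. of_nat (lookup \<gamma> i) ^ lookup m i))"
    for \<gamma> :: "'n composition"
  have v: "v \<gamma> = (\<Sum>m\<in>N. a m * (\<Prod>i\<in>UNIV. of_nat (lookup \<gamma> i) ^ lookup m i))" for \<gamma>
    unfolding v_def by (rule sum.mono_neutral_right) (use fin in \<open>auto simp: N_def\<close>)
  obtain W :: "('n \<Rightarrow> nat) \<Rightarrow> 'a" where W: "\<And>m :: 'n composition. csize m \<le> csize \<eta> \<Longrightarrow>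
      (\<Sum>g\<in>(\<Pi>\<^sub>E i\<in>UNIV. {..lookup \<eta> i}). W g * (\<Prod>i\<in>UNIV. of_nat (g i) ^ lookup m i))
        = (if m = \<eta> then 1 else 0)"
    using coeff_functional[of \<eta>, where 'a = 'a] by auto
  have "(\<Sum>g\<in>(\<Pi>\<^sub>E i\<in>UNIV. {..lookup \<eta> i}). W g * v (Abs_poly_mapping g))
      = (\<Sum>m\<in>N. a m * (\<Sum>g\<in>(\<Pi>\<^sub>E i\<in>UNIV. {..lookup \<eta> i}). W g * (\<Prod>i\<in>UNIV. of_nat (g i) ^ lookup m i)))"
    unfolding v sum_distrib_left by (subst sum.swap) (simp add: mult_ac)
  also have "\<dots> = (\<Sum>m\<in>N. a m * (if m = \<eta> then 1 else 0))"
    by (rule sum.cong) (use le W in auto)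
  also have "\<dots> = a \<eta>" using N \<eta> by (simp add: if_distrib cong: if_cong)
  finally have *: "(\<Sum>g\<in>(\<Pi>\<^sub>E i\<in>UNIV. {..lookup \<eta> i}). W g * v (Abs_poly_mapping g)) = a \<eta>" .
  have \<eta>': "\<eta> \<in> M" "a \<eta> \<noteq> 0" "csize \<eta> \<le> d" using \<eta> deg by (auto simp: N_def)
  \<comment> \<open>A box point other than \<eta> has size below \<open>csize \<eta>\<close>, hence
    below \<open>d\<close>. At \<eta> itself, \<open>low\<close> applies if
    \<open>csize \<eta> < d\<close>; otherwise \<open>top\<close> does, its first alternative being
    excluded.\<close>
  have "v (Abs_poly_mapping g) = 0" if g: "g \<in> (\<Pi>\<^sub>E i\<in>UNIV. {..lookup \<eta> i})" for g
  proof (cases "Abs_poly_mapping g = \<eta>")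
    case True
    then show ?thesis using low[of \<eta>] top[of \<eta>] \<eta>' unfolding v_def by fastforce
  next
    case False
    have "csize (Abs_poly_mapping g) < csize \<eta>"
      by (rule csize_less_of_le) (use g False in auto)
    then show ?thesis using low[of "Abs_poly_mapping g"] \<eta>' unfolding v_def by simp
  qed
  with * \<eta>' show False by simp
qed

subsection \<open>Specialization at $r = 0$\<close>

lemma common_denominator:
  fixes x :: "'b \<Rightarrow> 'a::idom fract"
  assumes "finite A"
  shows "\<exists>Q P. Q \<noteq> 0 \<and> (\<forall>m\<in>A. to_fract Q * x m = to_fract (P m))"
  using assms
proof (induction A)
  case empty
  show ?case by (auto intro: exI[of _ 1])
next
  case (insert b A)
  then obtain Q P where QP: "Q \<noteq> 0" "\<And>m. m \<in> A \<Longrightarrow> to_fract Q * x m = to_fract (P m)" by blast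
  obtain n e where ne: "x b = Fraction_Field.Fract n e" "e \<noteq> 0" by (cases "x b") auto
  then have xb: "to_fract e * x b = to_fract n" by (simp add: Fract_conv_to_fract)
  show ?case
  proof (intro exI conjI ballI)
    show "Q * e \<noteq> 0" using QP ne by simp
    fix m assume "m \<in> insert b A"
    then show "to_fract (Q * e) * x m = to_fract (if m = b then Q * n else e * P m)"
      using QP(2) xb by (auto simp: mult_ac)
  qed
qed

text \<open>Rescales a family that is not identically zero so that it lies in the polynomial ring
  and its reduction at r = 0 is not identically zero: clear denominators, then cancel common factors
  r.\<close>

lemma primitive_at_zero:
  fixes x :: "'b \<Rightarrow> 'a::field poly fract"
  assumes "finite A" and m0: "m0 \<in> A" "x m0 \<noteq> 0"
  obtains c P where "c \<noteq> 0" and "\<And>m. m \<in> A \<Longrightarrow> c * x m = to_fract (P m)"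
    and "\<exists>m\<in>A. poly (P m) 0 \<noteq> 0"
proof -
  have step: "\<exists>c P. c \<noteq> 0 \<and> (\<forall>m\<in>A. c * x m = to_fract (P m)) \<and> (\<exists>m\<in>A. poly (P m) 0 \<noteq> 0)"
    if "c \<noteq> 0" "\<forall>m\<in>A. c * x m = to_fract (P m)" for c :: "'a poly fract" and P
    using that
  proof (induction "degree (P m0)" arbitrary: c P rule: less_induct)
    case less
    show ?case
    proof (cases "\<exists>m\<in>A. poly (P m) 0 \<noteq> 0")
      case True
      then show ?thesis using less.prems by blast
    next
      case False
      define P' where "P' m = P m div [:0, 1:]" for m
      have P': "P m = [:0, 1:] * P' m" if "m \<in> A" for m
      proof -
        have "[:0, 1:] dvd P m" using False that poly_eq_0_iff_dvd[of "P m" 0] by simp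
        then show ?thesis by (simp only: P'_def dvd_mult_div_cancel)
      qed
      \<comment> \<open>The nonzero entry at \<open>m0\<close> ensures termination: its numerator
        stays nonzero, so cancelling r strictly lowers its degree.\<close>
      have "c * x m0 \<noteq> 0" using m0(2) less.prems(1) by simp
      then have "P m0 \<noteq> 0" using bspec[OF less.prems(2) m0(1)] by auto
      then have "degree (P' m0) < degree (P m0)" using P'[OF m0(1)] by auto
      moreover have "c / to_fract [:0, 1:] \<noteq> 0" using less.prems(1) by simp
      moreover have "\<forall>m\<in>A. c / to_fract [:0, 1:] * x m = to_fract (P' m)"
      proof
        fix m assume m: "m \<in> A"
        have "c * x m = to_fract [:0, 1:] * to_fract (P' m)"
          using bspec[OF less.prems(2) m] unfolding P'[OF m] by (simp only: to_fract_mult)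
        then show "c / to_fract [:0, 1:] * x m = to_fract (P' m)" by (simp add: field_simps)
      qed
      ultimately show ?thesis using less.hyps by blast
    qed
  qed
  obtain Q P where QP: "Q \<noteq> 0" "\<forall>m\<in>A. to_fract Q * x m = to_fract (P m)"
    using common_denominator[OF assms(1)] by metis
  have "to_fract Q \<noteq> 0" using QP(1) by simp
  from step[OF this QP(2)] that show ?thesis by blast
qed

subsection \<open>Polynomial arithmetic\<close>

lemma lookup_pscale [simp]: "lookup (pscale c p) m = c * lookup p m"
  unfolding pscale_def const_poly_def mult_map_scale_conv_mult[symmetric]
  by (simp add: Poly_Mapping.map.rep_eq when_def)

lemma lookup_monomial: "lookup (monomial \<eta>) m = (if m = \<eta> then 1 else 0)"
  by (auto simp: monomial_def lookup_single when_def)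

interpretation mpoly: vector_space "pscale :: ratfun \<Rightarrow> 'n mpolynomial \<Rightarrow> 'n mpolynomial"
  by unfold_locales
    (simp_all add: poly_mapping_eq_iff fun_eq_iff lookup_add algebra_simps)

interpretation mpoly: vector_space_pair
    "pscale :: ratfun \<Rightarrow> 'n mpolynomial \<Rightarrow> 'n mpolynomial"
    "pscale :: ratfun \<Rightarrow> 'n mpolynomial \<Rightarrow> 'n mpolynomial" ..

lemma peval_superset:
  assumes "finite M" and "keys p \<subseteq> M"
  shows "peval p v = (\<Sum>m\<in>M. lookup p m * (\<Prod>i\<in>UNIV. v i ^ lookup m i))"
  unfolding peval_def
  by (rule sum.mono_neutral_left) (use assms in \<open>auto simp: in_keys_iff\<close>)

lemma peval_add: "peval (p + q) v = peval p v + peval q v"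
proof -
  let ?M = "keys p \<union> keys q"
  have "keys (p + q) \<subseteq> ?M" by (rule keys_add)
  then show ?thesis
    by (simp add: peval_superset[of ?M] lookup_add distrib_right sum.distrib)
qed

lemma peval_pscale: "peval (pscale c p) v = c * peval p v"
proof -
  have "keys (pscale c p) \<subseteq> keys p" by (auto simp: in_keys_iff)
  then show ?thesis
    by (simp add: peval_superset[of "keys p"] sum_distrib_left mult.assoc)
qed

lemma peval_diff: "peval (p - q) v = peval p v - peval q v"
  using peval_add[of "p - q" q v] by simp

lemma peval_zero [simp]: "peval 0 v = 0"
  by (simp add: peval_def)

lemma peval_sum: "peval (\<Sum>a\<in>A. f a) v = (\<Sum>a\<in>A. peval (f a) v)"
  by (induction A rule: infinite_finite_induct) (simp_all add: peval_add)

text \<open>The value -1 at the zero polynomial makes this correct for \<open>d = 0\<close> as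
  well.\<close>

lemma tdegree_less_iff: "tdegree p < int d \<longleftrightarrow> (\<forall>m\<in>keys p. csize m < d)"
proof (cases "p = 0")
  case False
  then have "keys p \<noteq> {}" by simp
  then show ?thesis using False by (simp add: tdegree_def)
qed (simp add: tdegree_def)

lemma tdegree_le_iff: "tdegree p \<le> int d \<longleftrightarrow> (\<forall>m\<in>keys p. csize m \<le> d)"
proof -
  have "tdegree p \<le> int d \<longleftrightarrow> tdegree p < int (Suc d)" by linarith
  then show ?thesis by (simp only: tdegree_less_iff less_Suc_eq_le)
qed

lemma tdegree_eqI:
  assumes "\<And>m. m \<in> keys p \<Longrightarrow> csize m \<le> d" and "\<eta> \<in> keys p" and "csize \<eta> = d"
  shows "tdegree p = int d"
proof -
  have "tdegree p \<le> int d" using assms(1) by (simp add: tdegree_le_iff)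
  moreover have "\<not> tdegree p < int d" using assms(2,3) by (auto simp: tdegree_less_iff)
  ultimately show ?thesis by simp
qed

lemma lookup_top_component:
  "lookup (top_component p) m = (if int (csize m) = tdegree p then lookup p m else 0)"
  by (auto simp: top_component_def lookup_sum lookup_single when_def in_keys_iff)

lemma prod_single:
  "(\<Prod>i\<in>A. Poly_Mapping.single (f i) (c i)) = Poly_Mapping.single (\<Sum>i\<in>A. f i) (\<Prod>i\<in>A. c i)"
  for c :: "'i \<Rightarrow> 'b::comm_semiring_1" and f :: "'i \<Rightarrow> 'c::comm_monoid_add"
  by (induction A rule: infinite_finite_induct) (simp_all add: mult_single)

lemma uminus_var_poly_power:
  "(- var_poly i) ^ k = Poly_Mapping.single (Poly_Mapping.single i k) ((- 1) ^ k)"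
proof (induction k)
  case (Suc k)
  have v: "- var_poly i = Poly_Mapping.single (Poly_Mapping.single i 1) (- 1)"
    by (simp add: var_poly_def monomial_def single_uminus)
  show ?case
    unfolding power_Suc Suc.IH unfolding v by (simp add: mult_single single_add[symmetric])
qed simp

lemma sum_single_lookup: "(\<Sum>i\<in>UNIV. Poly_Mapping.single i (lookup m i)) = m"
  for m :: "'n::finite \<Rightarrow>\<^sub>0 'b::comm_monoid_add"
  by (rule poly_mapping_eqI) (simp add: lookup_sum lookup_single when_def)

text \<open>The product of the powers of \<open>- var_poly i\<close> is a single signed monomial, so
  the substitution acts diagonally on coefficients.\<close>

lemma lookup_subst_neg: "lookup (subst_neg p) m = (- 1) ^ csize m * lookup p m"
proof -
  have "subst_neg p = (\<Sum>m\<in>keys p. Poly_Mapping.single m ((- 1) ^ csize m * lookup p m))"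
    by (simp add: subst_neg_def uminus_var_poly_power prod_single sum_single_lookup const_poly_def
        mult_single csize_def power_sum mult.commute)
  then show ?thesis
    by (simp add: lookup_sum lookup_single when_def in_keys_iff)
qed

lemma keys_subst_neg [simp]: "keys (subst_neg p) = keys p"
  by (auto simp: in_keys_iff lookup_subst_neg)

lemma subst_neg_subst_neg [simp]: "subst_neg (subst_neg p) = p"
  by (rule poly_mapping_eqI) (simp add: lookup_subst_neg mult.assoc[symmetric] power_add[symmetric])

lemma subst_neg_add: "subst_neg (p + q) = subst_neg p + subst_neg q"
  by (rule poly_mapping_eqI) (simp add: lookup_subst_neg lookup_add distrib_left)

lemma subst_neg_pscale: "subst_neg (pscale c p) = pscale c (subst_neg p)"
  by (rule poly_mapping_eqI) (simp add: lookup_subst_neg mult_ac)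

lemma peval_subst_neg: "peval (subst_neg p) v = peval p (\<lambda>i. - v i)"
proof -
  have "(\<Prod>i\<in>UNIV. (- v i) ^ lookup m i) = (- 1) ^ csize m * (\<Prod>i\<in>UNIV. v i ^ lookup m i)" for m
    by (simp add: power_minus[of "v _"] prod.distrib csize_def power_sum)
  then show ?thesis
    by (simp add: peval_def lookup_subst_neg mult_ac)
qed

subsection \<open>Unisolvence at the points $\overline\gamma$\<close>

lemma to_fract_power [simp]: "to_fract (x ^ k) = to_fract x ^ k"
  by (induction k) simp_all

lemma to_fract_prod [simp]: "to_fract (\<Prod>i\<in>A. f i) = (\<Prod>i\<in>A. to_fract (f i))"
  by (induction A rule: infinite_finite_induct) simp_all

lemma to_fract_of_nat: "to_fract (of_nat k) = of_nat k"
  by (induction k) simp_all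

lemma r_ind_eq: "r_ind = to_fract [:0, 1:]"
  by (simp add: r_ind_def to_fract_def)

lemma linear_ratfun_eq: "of_nat a + r_ind * of_nat b = to_fract [:of_nat a, of_nat b:]"
proof -
  have "[:of_nat a, of_nat b:] = of_nat a + [:0, 1:] * (of_nat b :: rat poly)"
    by (simp add: of_nat_poly)
  then show ?thesis by (simp only: to_fract_add to_fract_mult to_fract_of_nat r_ind_eq)
qed

text \<open>
  The only property of the points that is needed: $\overline\gamma$ is $\gamma$ modulo $r$. In
  particular nothing has to be known about $w_\gamma$.
\<close>

lemma bar_eq:
  "bar \<gamma> i = to_fract [:of_nat (lookup \<gamma> i), of_nat (delta (inv (w_min \<gamma>) i)):]"
  by (simp add: bar_def perm_act_def linear_ratfun_eq)

text \<open>Scale the coefficients of a nonzero \<open>p\<close> to be primitive at r = 0. Reducing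
  modulo r turns vanishing at \<open>bar \<gamma>\<close> into vanishing at \<gamma>, and
  unisolvence on the lattice kills every reduced coefficient, a contradiction.\<close>

lemma interp_unique:
  fixes p :: "'n::{finite,linorder} mpolynomial"
  assumes deg: "\<And>m. m \<in> keys p \<Longrightarrow> csize m \<le> d"
    and low: "\<And>\<gamma>. csize \<gamma> < d \<Longrightarrow> peval p (bar \<gamma>) = 0"
    and top: "\<And>\<gamma>. csize \<gamma> = d \<Longrightarrow> lookup p \<gamma> = 0 \<or> peval p (bar \<gamma>) = 0"
  shows "p = 0"
proof (rule ccontr)
  assume "p \<noteq> 0"
  then obtain m0 where "m0 \<in> keys p" by fastforce
  then obtain c P where "c \<noteq> 0" and cP: "\<And>m. m \<in> keys p \<Longrightarrow> c * lookup p m = to_fract (P m)"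
    and P: "\<exists>m\<in>keys p. poly (P m) 0 \<noteq> 0"
    using primitive_at_zero[of "keys p" m0 "lookup p"] by (auto simp: in_keys_iff)
  have special: "(\<Sum>m\<in>keys p. poly (P m) 0 * (\<Prod>i\<in>UNIV. of_nat (lookup \<gamma> i) ^ lookup m i)) = 0"
    if "peval p (bar \<gamma>) = 0" for \<gamma>
  proof -
    \<comment> \<open>The coordinates of \<open>bar \<gamma>\<close> as polynomials in r, with value
      \<gamma> at r = 0. The polynomial sum below is thus both
      \<open>c * peval p (bar \<gamma>)\<close> and a lift of the lattice evaluation.\<close>
    define b where "b i = [:of_nat (lookup \<gamma> i), of_nat (delta (inv (w_min \<gamma>) i)) :: rat:]" for i
    have "to_fract (\<Sum>m\<in>keys p. P m * (\<Prod>i\<in>UNIV. b i ^ lookup m i)) = c * peval p (bar \<gamma>)"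
      by (simp add: peval_def sum_distrib_left mult.assoc[symmetric] cP bar_eq b_def)
    then have "(\<Sum>m\<in>keys p. P m * (\<Prod>i\<in>UNIV. b i ^ lookup m i)) = 0"
      by (simp only: that mult_zero_right to_fract_eq_0_iff)
    then have "poly (\<Sum>m\<in>keys p. P m * (\<Prod>i\<in>UNIV. b i ^ lookup m i)) 0 = 0"
      by simp
    then show ?thesis
      by (simp add: poly_sum poly_prod b_def)
  qed
  have "poly (P m) 0 = 0" if "m \<in> keys p" for m
  proof (rule lattice_unisolvent[of "keys p" d "\<lambda>m. poly (P m) 0"])
    fix \<gamma> assume "csize \<gamma> = d" "\<gamma> \<in> keys p"
    then show "poly (P \<gamma>) 0 = 0 \<or>
        (\<Sum>m\<in>keys p. poly (P m) 0 * (\<Prod>i\<in>UNIV. of_nat (lookup \<gamma> i) ^ lookup m i)) = 0"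
      using top[of \<gamma>] special by (auto simp: in_keys_iff)
  qed (use that deg low special in auto)
  then show False using P by blast
qed

section \<open>Existence of interpolants by counting dimensions\<close>

lemma (in vector_space) span_subset_inj_image:
  assumes lin: "Vector_Spaces.linear scale scale f" and "finite B" and "independent B"
    and "f ` B \<subseteq> span B" and inj: "inj_on f (span B)"
  shows "span B \<subseteq> f ` span B"
proof -
  interpret vector_space_pair scale scale ..
  have ind: "independent (f ` B)"
    by (rule linear_independent_injective_image[OF lin \<open>independent B\<close> inj])
  have card: "card (f ` B) = card B"
    by (rule card_image) (rule inj_on_subset[OF inj span_superset])
  have "B \<subseteq> span (f ` B)"
  proof
    fix v assume "v \<in> B"
    show "v \<in> span (f ` B)"
    proof (rule ccontr)
      assume v: "v \<notin> span (f ` B)"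
      then have "independent (insert v (f ` B))" using ind by (rule independent_insertI)
      moreover have "insert v (f ` B) \<subseteq> span B"
        using \<open>v \<in> B\<close> assms(4) span_base by auto
      ultimately have "card (insert v (f ` B)) \<le> card B"
        using independent_span_bound[OF \<open>finite B\<close>] by blast
      moreover have "v \<notin> f ` B" using v span_base by blast
      ultimately show False using \<open>finite B\<close> card by simp
    qed
  qed
  then have "span B \<subseteq> span (f ` B)" by (rule span_minimal) (rule subspace_span)
  then show ?thesis by (simp add: linear_span_image[OF lin])
qed

lemma poly_mapping_sum_monomials: "p = (\<Sum>m\<in>keys p. pscale (lookup p m) (monomial m))"
  by (rule poly_mapping_eqI) (simp add: lookup_sum lookup_monomial in_keys_iff if_distrib cong: if_cong)

lemma span_monomials: "mpoly.span (monomial ` S) = {p. keys p \<subseteq> S}"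
proof
  show "mpoly.span (monomial ` S) \<subseteq> {p. keys p \<subseteq> S}"
  proof (rule mpoly.span_minimal)
    show "mpoly.subspace {p. keys p \<subseteq> S}"
      unfolding mpoly.subspace_def
    proof (intro conjI ballI allI)
      fix p q :: "'a mpolynomial"
      assume "p \<in> {p. keys p \<subseteq> S}" "q \<in> {p. keys p \<subseteq> S}"
      then show "p + q \<in> {p. keys p \<subseteq> S}" using keys_add[of p q] by blast
    qed (auto simp: in_keys_iff)
  qed (auto simp: monomial_def)
  show "{p. keys p \<subseteq> S} \<subseteq> mpoly.span (monomial ` S)"
  proof
    fix p :: "'a mpolynomial" assume "p \<in> {p. keys p \<subseteq> S}"
    then have "(\<Sum>m\<in>keys p. pscale (lookup p m) (monomial m)) \<in> mpoly.span (monomial ` S)"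
      by (intro mpoly.span_sum mpoly.span_scale mpoly.span_base) auto
    then show "p \<in> mpoly.span (monomial ` S)"
      by (simp only: poly_mapping_sum_monomials[symmetric])
  qed
qed

lemma inj_monomial: "inj_on monomial S"
  by (rule inj_onI) (metis lookup_monomial zero_neq_one)

lemma independent_monomials:
  assumes "finite S" shows "mpoly.independent (monomial ` S)"
proof (rule mpoly.independent_if_scalars_zero)
  show "finite (monomial ` S)" using assms by simp
  fix f x assume 0: "(\<Sum>x\<in>monomial ` S. pscale (f x) x) = 0" and "x \<in> monomial ` S"
  then obtain m where m: "m \<in> S" "x = monomial m" by blast
  have "f (monomial m) = lookup (\<Sum>x\<in>monomial ` S. pscale (f x) x) m"
    using m assms
    by (simp add: sum.reindex[OF inj_monomial] lookup_sum lookup_monomial if_distrib cong: if_cong)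
  then show "f x = 0" using 0 m by simp
qed

text \<open>The map from a polynomial of degree at most \<open>d\<close> to its data is injective by
  \<open>interp_unique\<close>, hence surjective. The set \<open>C\<close> selects the top-size
  compositions at which a coefficient is prescribed in place of a value.\<close>

lemma interp_exists:
  fixes C :: "'n::{finite,linorder} composition set" and y :: "'n composition \<Rightarrow> ratfun"
  obtains p where "\<And>m. m \<in> keys p \<Longrightarrow> csize m \<le> d"
    and "\<And>\<gamma>. csize \<gamma> < d \<Longrightarrow> peval p (bar \<gamma>) = y \<gamma>"
    and "\<And>\<gamma>. csize \<gamma> = d \<Longrightarrow> \<gamma> \<in> C \<Longrightarrow> lookup p \<gamma> = y \<gamma>"
    and "\<And>\<gamma>. csize \<gamma> = d \<Longrightarrow> \<gamma> \<notin> C \<Longrightarrow> peval p (bar \<gamma>) = y \<gamma>"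
proof -
  define S where "S = {m :: 'n composition. csize m \<le> d}"
  have S: "finite S" by (simp add: S_def)
  define \<phi> where "\<phi> \<gamma> p = (if csize \<gamma> = d \<and> \<gamma> \<in> C then lookup p \<gamma> else peval p (bar \<gamma>))"
    for \<gamma> :: "'n composition" and p
  \<comment> \<open>Storing the datum of \<gamma> as the coefficient of x^\<gamma> makes the data
    map an endomorphism of the space of polynomials of degree at most \<open>d\<close>.\<close>
  define L where "L p = (\<Sum>\<gamma>\<in>S. Poly_Mapping.single \<gamma> (\<phi> \<gamma> p))" for p
  have lookup_L: "lookup (L p) m = (if m \<in> S then \<phi> m p else 0)" for p m
    using S by (simp add: L_def lookup_sum lookup_single when_def)
  have lin: "Vector_Spaces.linear pscale pscale L"
    unfolding Vector_Spaces.linear_iff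
    by (auto intro!: poly_mapping_eqI mpoly.vector_space_axioms
        simp: lookup_L \<phi>_def lookup_add peval_add peval_pscale)
  have span: "mpoly.span (monomial ` S) = {p. keys p \<subseteq> S}"
    by (rule span_monomials)
  have keys_L: "keys (L p) \<subseteq> S" for p
    by (auto simp: in_keys_iff lookup_L split: if_splits)
  have inj: "inj_on L (mpoly.span (monomial ` S))"
  proof (subst mpoly.linear_inj_on_iff_eq_0[OF lin])
    show "\<forall>p\<in>mpoly.span (monomial ` S). L p = 0 \<longrightarrow> p = 0"
    proof (intro ballI impI)
      fix p assume p: "p \<in> mpoly.span (monomial ` S)" and "L p = 0"
      then have 0: "\<phi> \<gamma> p = 0" if "\<gamma> \<in> S" for \<gamma>
        using that lookup_L[of p \<gamma>] by simp
      show "p = 0"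
      proof (rule interp_unique)
        fix m assume "m \<in> keys p" then show "csize m \<le> d" using p unfolding span by (auto simp: S_def)
      next
        fix \<gamma> :: "'n composition" assume "csize \<gamma> < d"
        then show "peval p (bar \<gamma>) = 0" using 0[of \<gamma>] by (simp add: S_def \<phi>_def)
      next
        fix \<gamma> :: "'n composition" assume "csize \<gamma> = d"
        then show "lookup p \<gamma> = 0 \<or> peval p (bar \<gamma>) = 0"
          using 0[of \<gamma>] by (auto simp: S_def \<phi>_def split: if_splits)
      qed
    qed
  qed (rule mpoly.subspace_span)
  \<comment> \<open>The prescribed data in the same encoding; a preimage under \<open>L\<close> is
    the interpolant.\<close>
  define q where "q = (\<Sum>\<gamma>\<in>S. Poly_Mapping.single \<gamma> (y \<gamma>))"
  have lookup_q: "lookup q m = (if m \<in> S then y m else 0)" for m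
    using S by (simp add: q_def lookup_sum lookup_single when_def)
  have "mpoly.span (monomial ` S) \<subseteq> L ` mpoly.span (monomial ` S)"
    by (rule mpoly.span_subset_inj_image[OF lin _ independent_monomials _ inj])
      (use S keys_L in \<open>auto simp: span\<close>)
  moreover have "q \<in> mpoly.span (monomial ` S)"
    by (auto simp: span in_keys_iff lookup_q split: if_splits)
  ultimately obtain p where p: "keys p \<subseteq> S" "L p = q"
    unfolding span by auto
  have \<phi>: "\<phi> \<gamma> p = y \<gamma>" if "csize \<gamma> \<le> d" for \<gamma>
    using that lookup_L[of p \<gamma>] lookup_q[of \<gamma>] p(2) by (simp add: S_def)
  show thesis
  proof
    show "csize m \<le> d" if "m \<in> keys p" for m using p that by (auto simp: S_def)
    show "peval p (bar \<gamma>) = y \<gamma>" if "csize \<gamma> < d" for \<gamma>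
      using \<phi>[of \<gamma>] that by (simp add: \<phi>_def)
    show "lookup p \<gamma> = y \<gamma>" if "csize \<gamma> = d" "\<gamma> \<in> C" for \<gamma>
      using \<phi>[of \<gamma>] that by (simp add: \<phi>_def)
    show "peval p (bar \<gamma>) = y \<gamma>" if "csize \<gamma> = d" "\<gamma> \<notin> C" for \<gamma>
      using \<phi>[of \<gamma>] that by (simp add: \<phi>_def)
  qed
qed

lemma interp_eqI:
  fixes p q :: "'n::{finite,linorder} mpolynomial"
  assumes "\<And>m. m \<in> keys p \<Longrightarrow> csize m \<le> d" and "\<And>m. m \<in> keys q \<Longrightarrow> csize m \<le> d"
    and "\<And>\<gamma>. csize \<gamma> < d \<Longrightarrow> peval p (bar \<gamma>) = peval q (bar \<gamma>)"
    and "\<And>\<gamma>. csize \<gamma> = d \<Longrightarrow> lookup p \<gamma> = lookup q \<gamma> \<or> peval p (bar \<gamma>) = peval q (bar \<gamma>)"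
  shows "p = q"
proof -
  have "p - q = 0"
  proof (rule interp_unique)
    fix m assume "m \<in> keys (p - q)"
    then have "m \<in> keys p \<or> m \<in> keys q" by (auto simp: in_keys_iff lookup_minus)
    then show "csize m \<le> d" using assms(1,2) by blast
  qed (use assms(3,4) in \<open>auto simp: peval_diff lookup_minus\<close>)
  then show ?thesis by simp
qed

subsection \<open>The lift and the operator $\Xi$\<close>

definition is_E_interp :: "'n::{finite,linorder} composition \<Rightarrow> 'n mpolynomial \<Rightarrow> bool" where
  "is_E_interp \<eta> p \<longleftrightarrow>
     tdegree p = int (csize \<eta>) \<and>
     (\<forall>\<gamma>. \<gamma> \<noteq> \<eta> \<and> csize \<gamma> \<le> csize \<eta> \<longrightarrow> peval p (bar \<gamma>) = 0) \<and>
     lookup p \<eta> = 1"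

text \<open>Existence and uniqueness both come from mixed data: the coefficient at \<eta>, and the
  values at all other compositions of size at most \<open>csize \<eta>\<close>.\<close>

lemma is_E_interp_E_interp: "is_E_interp \<eta> (E_interp \<eta>)"
proof -
  define d where "d = csize \<eta>"
  \<comment> \<open>With \<open>C = {\<eta>}\<close> the datum 1 at \<eta> is a coefficient, while
    every other datum is a value 0.\<close>
  obtain p :: "'a mpolynomial" where p: "\<And>m. m \<in> keys p \<Longrightarrow> csize m \<le> d"
    "\<And>\<gamma>. csize \<gamma> < d \<Longrightarrow> peval p (bar \<gamma>) = (if \<gamma> = \<eta> then 1 else 0)"
    "\<And>\<gamma>. csize \<gamma> = d \<Longrightarrow> \<gamma> \<in> {\<eta>} \<Longrightarrow> lookup p \<gamma> = (if \<gamma> = \<eta> then 1 else 0)"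
    "\<And>\<gamma>. csize \<gamma> = d \<Longrightarrow> \<gamma> \<notin> {\<eta>} \<Longrightarrow> peval p (bar \<gamma>) = (if \<gamma> = \<eta> then 1 else 0)"
    by (rule interp_exists[where d = d and C = "{\<eta>}" and y = "\<lambda>\<gamma>. if \<gamma> = \<eta> then 1 else 0"]) blast
  have "lookup p \<eta> = 1" using p(3)[of \<eta>] by (simp add: d_def)
  moreover from this have "tdegree p = int d"
    by (intro tdegree_eqI[of p d \<eta>] p(1)) (simp_all add: in_keys_iff d_def)
  moreover have "peval p (bar \<gamma>) = 0" if "\<gamma> \<noteq> \<eta>" "csize \<gamma> \<le> csize \<eta>" for \<gamma>
    using p(2)[of \<gamma>] p(4)[of \<gamma>] that by (cases "csize \<gamma> = d") (auto simp: d_def)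
  ultimately have "is_E_interp \<eta> p" by (simp add: is_E_interp_def d_def)
  moreover have "q = p" if q: "is_E_interp \<eta> q" for q
  proof (rule interp_eqI[where d = d])
    show "csize m \<le> d" if "m \<in> keys q" for m
      using q that tdegree_le_iff[of q d] by (simp add: is_E_interp_def d_def)
    show "peval q (bar \<gamma>) = peval p (bar \<gamma>)" if "csize \<gamma> < d" for \<gamma>
    proof -
      have "\<gamma> \<noteq> \<eta>" "csize \<gamma> \<le> csize \<eta>" using that by (auto simp: d_def)
      then show ?thesis using q \<open>is_E_interp \<eta> p\<close> unfolding is_E_interp_def by metis
    qed
    show "lookup q \<gamma> = lookup p \<gamma> \<or> peval q (bar \<gamma>) = peval p (bar \<gamma>)" if "csize \<gamma> = d" for \<gamma>
      using q \<open>is_E_interp \<eta> p\<close> that unfolding is_E_interp_def d_def by (metis order_refl)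
  qed (rule p(1))
  ultimately have "\<exists>!p. is_E_interp \<eta> p" by blast
  then have "is_E_interp \<eta> (THE p. is_E_interp \<eta> p)" by (rule theI')
  then show ?thesis by (simp add: E_interp_def is_E_interp_def)
qed

lemma lookup_E_interp_self: "lookup (E_interp \<eta>) \<eta> = 1"
  using is_E_interp_E_interp by (auto simp: is_E_interp_def)

lemma peval_E_interp_eq_0:
  "\<gamma> \<noteq> \<eta> \<Longrightarrow> csize \<gamma> \<le> csize \<eta> \<Longrightarrow> peval (E_interp \<eta>) (bar \<gamma>) = 0"
  using is_E_interp_E_interp by (auto simp: is_E_interp_def)

lemma tdegree_E_interp: "tdegree (E_interp \<eta>) = int (csize \<eta>)"
  using is_E_interp_E_interp by (auto simp: is_E_interp_def)

lemma keys_E_interp: "m \<in> keys (E_interp \<eta>) \<Longrightarrow> csize m \<le> csize \<eta>"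
  using tdegree_le_iff[of "E_interp \<eta>" "csize \<eta>"] by (simp add: tdegree_E_interp)

text \<open>Otherwise the polynomial would vanish at every node of size at most its degree, hence be
  0, against its coefficient 1. This permits its use as a Lagrange basis element.\<close>

lemma peval_E_interp_self: "peval (E_interp \<eta>) (bar \<eta>) \<noteq> 0"
proof
  assume "peval (E_interp \<eta>) (bar \<eta>) = 0"
  then have "peval (E_interp \<eta>) (bar \<gamma>) = 0" if "csize \<gamma> \<le> csize \<eta>" for \<gamma>
    using that peval_E_interp_eq_0 by metis
  then have "E_interp \<eta> = 0"
    by (intro interp_unique[where d = "csize \<eta>"]) (auto dest: keys_E_interp)
  then show False using lookup_E_interp_self[of \<eta>] by simp
qed

lemma lookup_E_jack:
  "lookup (E_jack \<eta>) m = (if csize m = csize \<eta> then lookup (E_interp \<eta>) m else 0)"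
  by (simp add: E_jack_def lookup_top_component tdegree_E_interp)

section \<open>Lifting homogeneous polynomials\<close>

text \<open>The chosen polynomial exists by \<open>interp_exists\<close> and is unique by
  \<open>interp_unique\<close>. Fixing the lift on monomials first makes its extension
  \<open>interp_lift\<close> linear by construction.\<close>

definition interp_lift_monomial :: "'n::{finite,linorder} composition \<Rightarrow> 'n mpolynomial" where
  "interp_lift_monomial \<eta> = (SOME p. (\<forall>m\<in>keys p. csize m \<le> csize \<eta>) \<and>
     (\<forall>\<gamma>. csize \<gamma> < csize \<eta> \<longrightarrow> peval p (bar \<gamma>) = 0) \<and>
     (\<forall>\<gamma>. csize \<gamma> = csize \<eta> \<longrightarrow> lookup p \<gamma> = lookup (monomial \<eta>) \<gamma>))"

lemma interp_lift_monomial: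
  fixes \<eta> :: "'n::{finite,linorder} composition"
  shows "m \<in> keys (interp_lift_monomial \<eta>) \<Longrightarrow> csize m \<le> csize \<eta>"
    and "csize \<gamma> < csize \<eta> \<Longrightarrow> peval (interp_lift_monomial \<eta>) (bar \<gamma>) = 0"
    and "csize \<gamma> = csize \<eta> \<Longrightarrow> lookup (interp_lift_monomial \<eta>) \<gamma> = lookup (monomial \<eta>) \<gamma>"
proof -
  \<comment> \<open>Taking \<open>C = UNIV\<close> prescribes all coefficients of top size, and
    values only at smaller nodes.\<close>
  have "\<exists>p :: 'n mpolynomial. (\<forall>m\<in>keys p. csize m \<le> csize \<eta>) \<and>
     (\<forall>\<gamma>. csize \<gamma> < csize \<eta> \<longrightarrow> peval p (bar \<gamma>) = 0) \<and>
     (\<forall>\<gamma>. csize \<gamma> = csize \<eta> \<longrightarrow> lookup p \<gamma> = lookup (monomial \<eta>) \<gamma>)"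
    by (rule interp_exists[where d = "csize \<eta>" and C = UNIV
          and y = "\<lambda>\<gamma>. if csize \<gamma> < csize \<eta> then 0 else lookup (monomial \<eta>) \<gamma>"]) auto
  note * = someI_ex[OF this, folded interp_lift_monomial_def]
  show "m \<in> keys (interp_lift_monomial \<eta>) \<Longrightarrow> csize m \<le> csize \<eta>"
    and "csize \<gamma> < csize \<eta> \<Longrightarrow> peval (interp_lift_monomial \<eta>) (bar \<gamma>) = 0"
    and "csize \<gamma> = csize \<eta> \<Longrightarrow> lookup (interp_lift_monomial \<eta>) \<gamma> = lookup (monomial \<eta>) \<gamma>"
    using * by blast+
qed

text \<open>Meaningful on homogeneous polynomials: the top component is kept, and lower terms are added
  so that the values at all $\overline\gamma$ of smaller size vanish.\<close>

definition interp_lift :: "'n::{finite,linorder} mpolynomial \<Rightarrow> 'n mpolynomial" where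
  "interp_lift p = (\<Sum>m\<in>keys p. pscale (lookup p m) (interp_lift_monomial m))"

lemma interp_lift_superset:
  assumes "finite M" and "keys p \<subseteq> M"
  shows "interp_lift p = (\<Sum>m\<in>M. pscale (lookup p m) (interp_lift_monomial m))"
  unfolding interp_lift_def
  by (rule sum.mono_neutral_left) (use assms in \<open>auto simp: in_keys_iff\<close>)

lemma interp_lift_add: "interp_lift (p + q) = interp_lift p + interp_lift q"
proof -
  let ?M = "keys p \<union> keys q"
  have "keys (p + q) \<subseteq> ?M" by (rule keys_add)
  then show ?thesis
    by (simp add: interp_lift_superset[of ?M] lookup_add mpoly.scale_left_distrib sum.distrib)
qed

lemma interp_lift_pscale: "interp_lift (pscale c p) = pscale c (interp_lift p)"
proof -
  have "keys (pscale c p) \<subseteq> keys p" by (auto simp: in_keys_iff)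
  then show ?thesis
    by (simp add: interp_lift_superset[of "keys p"] mpoly.scale_sum_right)
qed

text \<open>Inherited by linearity from the monomials; homogeneity makes their bounds and nodes the
  same for all terms.\<close>

lemma interp_lift_homogeneous:
  assumes hom: "\<And>m. m \<in> keys p \<Longrightarrow> csize m = d"
  shows "m \<in> keys (interp_lift p) \<Longrightarrow> csize m \<le> d"
    and "csize \<gamma> < d \<Longrightarrow> peval (interp_lift p) (bar \<gamma>) = 0"
    and "csize \<gamma> = d \<Longrightarrow> lookup (interp_lift p) \<gamma> = lookup p \<gamma>"
proof -
  assume "m \<in> keys (interp_lift p)"
  then have "(\<Sum>l\<in>keys p. lookup p l * lookup (interp_lift_monomial l) m) \<noteq> 0"
    by (simp add: interp_lift_def in_keys_iff lookup_sum)
  then obtain l where "l \<in> keys p" "lookup p l * lookup (interp_lift_monomial l) m \<noteq> 0"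
    by (meson sum.neutral)
  then show "csize m \<le> d" using hom interp_lift_monomial(1)[of m l] by (auto simp: in_keys_iff)
next
  assume "csize \<gamma> < d"
  then show "peval (interp_lift p) (bar \<gamma>) = 0"
    unfolding interp_lift_def peval_sum peval_pscale
    by (intro sum.neutral) (auto simp: hom interp_lift_monomial(2))
next
  assume \<gamma>: "csize \<gamma> = d"
  have "lookup (interp_lift p) \<gamma> = (\<Sum>m\<in>keys p. lookup p m * lookup (monomial m) \<gamma>)"
    unfolding interp_lift_def lookup_sum lookup_pscale
    by (rule sum.cong) (auto simp: hom \<gamma> interp_lift_monomial(3))
  also have "\<dots> = lookup (\<Sum>m\<in>keys p. pscale (lookup p m) (monomial m)) \<gamma>"
    by (simp add: lookup_sum)
  finally show "lookup (interp_lift p) \<gamma> = lookup p \<gamma>"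
    by (simp only: poly_mapping_sum_monomials[symmetric])
qed

text \<open>Both sides have the same coefficients in degree \<open>csize \<eta>\<close> and vanish
  at all smaller nodes, so unisolvence identifies them.\<close>

lemma interp_lift_E_jack: "interp_lift (E_jack \<eta>) = E_interp \<eta>"
proof (rule interp_eqI[where d = "csize \<eta>"])
  have hom: "csize m = csize \<eta>" if "m \<in> keys (E_jack \<eta>)" for m
    using that by (auto simp: in_keys_iff lookup_E_jack split: if_splits)
  note l = interp_lift_homogeneous[of "E_jack \<eta>" "csize \<eta>", OF hom]
  show "csize m \<le> csize \<eta>" if "m \<in> keys (interp_lift (E_jack \<eta>))" for m
    using l(1) that by blast
  show "peval (interp_lift (E_jack \<eta>)) (bar \<gamma>) = peval (E_interp \<eta>) (bar \<gamma>)"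
    if "csize \<gamma> < csize \<eta>" for \<gamma>
    using l(2)[of \<gamma>] peval_E_interp_eq_0[of \<gamma> \<eta>] that by fastforce
  show "lookup (interp_lift (E_jack \<eta>)) \<gamma> = lookup (E_interp \<eta>) \<gamma> \<or>
      peval (interp_lift (E_jack \<eta>)) (bar \<gamma>) = peval (E_interp \<eta>) (bar \<gamma>)"
    if "csize \<gamma> = csize \<eta>" for \<gamma>
    using l(3)[of \<gamma>] that by (simp add: lookup_E_jack)
qed (rule keys_E_interp)

section \<open>Spanning by the nonsymmetric Jack polynomials, and identification of
  \<open>Xi\<close>\<close>

text \<open>The lift of x^\<eta> vanishes at all nodes of size below \<open>d\<close>, so Lagrange
  interpolation at the nodes of size \<open>d\<close> writes it in the
  \<open>E_interp \<gamma>\<close> with \<open>csize \<gamma> = d\<close>. Taking top components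
  gives the claim.\<close>

lemma monomial_in_span_E_jack: "monomial \<eta> \<in> mpoly.span (range E_jack)"
proof -
  define d where "d = csize \<eta>"
  define S where "S = {\<gamma> :: 'a composition. csize \<gamma> = d}"
  have S: "finite S" by (rule finite_subset[OF _ finite_csize_le[of d]]) (auto simp: S_def)
  \<comment> \<open>Lagrange coefficients: among the nodes of size \<open>d\<close>,
    \<open>E_interp \<gamma>\<close> is nonzero exactly at \<open>bar \<gamma>\<close>.\<close>
  define c where "c \<gamma> = peval (interp_lift_monomial \<eta>) (bar \<gamma>) / peval (E_interp \<gamma>) (bar \<gamma>)" for \<gamma>
  have expansion: "interp_lift_monomial \<eta> = (\<Sum>\<gamma>\<in>S. pscale (c \<gamma>) (E_interp \<gamma>))"
  proof (rule interp_eqI[where d = d])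
    show "csize m \<le> d" if "m \<in> keys (interp_lift_monomial \<eta>)" for m
      using that interp_lift_monomial(1) by (auto simp: d_def)
    show "csize m \<le> d" if "m \<in> keys (\<Sum>\<gamma>\<in>S. pscale (c \<gamma>) (E_interp \<gamma>))" for m
    proof -
      have "(\<Sum>\<gamma>\<in>S. c \<gamma> * lookup (E_interp \<gamma>) m) \<noteq> 0"
        using that by (simp add: in_keys_iff lookup_sum)
      then obtain \<gamma> where "\<gamma> \<in> S" "c \<gamma> * lookup (E_interp \<gamma>) m \<noteq> 0" by (meson sum.neutral)
      then show ?thesis using keys_E_interp[of m \<gamma>] by (auto simp: S_def in_keys_iff)
    qed
    show "peval (interp_lift_monomial \<eta>) (bar \<gamma>) = peval (\<Sum>\<gamma>\<in>S. pscale (c \<gamma>) (E_interp \<gamma>)) (bar \<gamma>)"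
      if "csize \<gamma> < d" for \<gamma>
    proof -
      have "peval (E_interp \<zeta>) (bar \<gamma>) = 0" if "\<zeta> \<in> S" for \<zeta>
        using that \<open>csize \<gamma> < d\<close> by (intro peval_E_interp_eq_0) (auto simp: S_def)
      then show ?thesis
        using that by (simp add: peval_sum peval_pscale interp_lift_monomial(2) d_def)
    qed
    show "lookup (interp_lift_monomial \<eta>) \<gamma> = lookup (\<Sum>\<gamma>\<in>S. pscale (c \<gamma>) (E_interp \<gamma>)) \<gamma> \<or>
        peval (interp_lift_monomial \<eta>) (bar \<gamma>) = peval (\<Sum>\<gamma>\<in>S. pscale (c \<gamma>) (E_interp \<gamma>)) (bar \<gamma>)"
      if "csize \<gamma> = d" for \<gamma>
    proof (rule disjI2)
      have "peval (\<Sum>\<gamma>\<in>S. pscale (c \<gamma>) (E_interp \<gamma>)) (bar \<gamma>)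
          = (\<Sum>\<zeta>\<in>S. c \<zeta> * peval (E_interp \<zeta>) (bar \<gamma>))"
        by (simp add: peval_sum peval_pscale)
      also have "\<dots> = (\<Sum>\<zeta>\<in>S. if \<zeta> = \<gamma> then c \<gamma> * peval (E_interp \<gamma>) (bar \<gamma>) else 0)"
      proof (rule sum.cong)
        fix \<zeta> assume "\<zeta> \<in> S"
        then have "peval (E_interp \<zeta>) (bar \<gamma>) = 0" if "\<zeta> \<noteq> \<gamma>"
          using that \<open>csize \<gamma> = d\<close> by (intro peval_E_interp_eq_0) (auto simp: S_def)
        then show "c \<zeta> * peval (E_interp \<zeta>) (bar \<gamma>)
            = (if \<zeta> = \<gamma> then c \<gamma> * peval (E_interp \<gamma>) (bar \<gamma>) else 0)" by simp
      qed simp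
      also have "\<dots> = c \<gamma> * peval (E_interp \<gamma>) (bar \<gamma>)"
        using S that by (simp add: S_def)
      also have "\<dots> = peval (interp_lift_monomial \<eta>) (bar \<gamma>)"
        by (simp add: c_def peval_E_interp_self)
      finally show "peval (interp_lift_monomial \<eta>) (bar \<gamma>)
          = peval (\<Sum>\<gamma>\<in>S. pscale (c \<gamma>) (E_interp \<gamma>)) (bar \<gamma>)" by simp
    qed
  qed
  \<comment> \<open>Both sides are homogeneous of degree \<open>d\<close>; in that degree they have
    the coefficients of the two sides of \<open>expansion\<close>.\<close>
  have "monomial \<eta> = (\<Sum>\<gamma>\<in>S. pscale (c \<gamma>) (E_jack \<gamma>))"
  proof (rule poly_mapping_eqI)
    fix m
    show "lookup (monomial \<eta>) m = lookup (\<Sum>\<gamma>\<in>S. pscale (c \<gamma>) (E_jack \<gamma>)) m"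
    proof (cases "csize m = d")
      case True
      then have "lookup (monomial \<eta>) m = lookup (interp_lift_monomial \<eta>) m"
        by (simp add: d_def interp_lift_monomial(3))
      also have "\<dots> = (\<Sum>\<gamma>\<in>S. c \<gamma> * lookup (E_interp \<gamma>) m)"
        unfolding expansion by (simp add: lookup_sum)
      also have "\<dots> = lookup (\<Sum>\<gamma>\<in>S. pscale (c \<gamma>) (E_jack \<gamma>)) m"
        unfolding lookup_sum by (rule sum.cong) (use True in \<open>auto simp: lookup_E_jack S_def\<close>)
      finally show ?thesis .
    next
      case False
      then have "lookup (monomial \<eta>) m = 0" by (auto simp: lookup_monomial d_def)
      moreover have "lookup (\<Sum>\<gamma>\<in>S. pscale (c \<gamma>) (E_jack \<gamma>)) m = 0"
        unfolding lookup_sum by (rule sum.neutral) (use False in \<open>auto simp: lookup_E_jack S_def\<close>)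
      ultimately show ?thesis by simp
    qed
  qed
  also have "\<dots> \<in> mpoly.span (range E_jack)"
    by (intro mpoly.span_sum mpoly.span_scale mpoly.span_base) auto
  finally show ?thesis .
qed

text \<open>Multiplied by r, each factor becomes (a+1) + r(l+1), a nonzero polynomial in r.\<close>

lemma d_coeff_nonzero: "d_coeff \<eta> \<noteq> 0"
proof -
  have "alpha * (of_nat a + 1) + of_nat l + 1 \<noteq> 0" for a l
  proof
    have r: "r_ind \<noteq> 0" by (simp add: r_ind_eq)
    assume "alpha * (of_nat a + 1) + of_nat l + 1 = 0"
    then have "r_ind * (alpha * (of_nat a + 1) + of_nat l + 1) = 0" by simp
    moreover have "r_ind * (alpha * (of_nat a + 1) + of_nat l + 1)
        = of_nat (Suc a) + r_ind * of_nat (Suc l)"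
      using r by (simp add: alpha_def field_simps)
    ultimately have "[:of_nat (Suc a), of_nat (Suc l):] = (0 :: rat poly)"
      by (simp only: linear_ratfun_eq to_fract_eq_0_iff)
    then show False by (simp del: of_nat_Suc)
  qed
  then show ?thesis by (simp add: d_coeff_def)
qed

lemma span_F_jack: "mpoly.span (range F_jack) = UNIV"
proof -
  have "E_jack \<eta> \<in> mpoly.span (range F_jack)" for \<eta>
  proof -
    have "E_jack \<eta> = pscale (1 / d_coeff \<eta>) (F_jack \<eta>)"
      by (simp add: F_jack_def d_coeff_nonzero)
    then show ?thesis by (metis mpoly.span_scale mpoly.span_base rangeI)
  qed
  then have "mpoly.span (range E_jack) \<subseteq> mpoly.span (range F_jack)"
    by (intro mpoly.span_minimal mpoly.subspace_span) auto
  then have "monomial \<eta> \<in> mpoly.span (range F_jack)" for \<eta>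
    using monomial_in_span_E_jack by blast
  then have "mpoly.span (range monomial) \<subseteq> mpoly.span (range F_jack)"
    by (intro mpoly.span_minimal mpoly.subspace_span) auto
  then show ?thesis by (auto simp: span_monomials)
qed

text \<open>The lift sends \<open>E_jack \<eta>\<close> to \<open>E_interp \<eta>\<close>;
  conjugating it by x \<mapsto> -x supplies the reflection and the sign in \<open>F_interp\<close>.
  Linearity and \<open>span_F_jack\<close> leave no other candidate.\<close>

lemma Xi_eq:
  fixes p :: "'n::{finite,linorder} mpolynomial"
  shows "Xi p = subst_neg (interp_lift (subst_neg p))"
proof -
  define T where "T p = subst_neg (interp_lift (subst_neg p))" for p :: "'n mpolynomial"
  have T: "Vector_Spaces.linear pscale pscale T"
    unfolding Vector_Spaces.linear_iff
    by (auto intro!: mpoly.vector_space_axioms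
        simp: T_def subst_neg_add subst_neg_pscale interp_lift_add interp_lift_pscale)
  have T_F: "T (F_jack \<eta>) = F_interp \<eta>" for \<eta>
  proof -
    \<comment> \<open>Homogeneity turns the inner substitution into the scalar (-1)^|\<eta>| that
      occurs in \<open>F_interp\<close>.\<close>
    have "subst_neg (E_jack \<eta>) = pscale ((- 1) ^ csize \<eta>) (E_jack \<eta>)"
      by (rule poly_mapping_eqI) (simp add: lookup_subst_neg lookup_E_jack)
    then show ?thesis
      by (simp add: T_def F_jack_def F_interp_def subst_neg_pscale interp_lift_pscale interp_lift_E_jack mult.commute)
  qed
  have "Xi = T"
    unfolding Xi_def
  proof (rule the_equality)
    fix U :: "'n mpolynomial \<Rightarrow> 'n mpolynomial"
    assume U: "Vector_Spaces.linear pscale pscale U \<and> (\<forall>\<eta>. U (F_jack \<eta>) = F_interp \<eta>)"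
    show "U = T"
    proof
      fix p
      show "U p = T p"
        by (rule mpoly.linear_eq_on[of U T p "range F_jack"]) (use U T T_F in \<open>auto simp: span_F_jack\<close>)
    qed
  qed (use T T_F in auto)
  then have "Xi p = T p" by (rule fun_cong)
  then show ?thesis by (simp only: T_def)
qed

text \<open>The properties of the lift carried through the conjugation: the zeros move from
  \<open>bar \<gamma>\<close> to its negative, and in degree \<open>csize \<eta>\<close> the two
  signs cancel.\<close>

lemma bar_monomial:
  shows "m \<in> keys (bar_monomial \<eta>) \<Longrightarrow> csize m \<le> csize \<eta>"
    and "csize \<gamma> < csize \<eta> \<Longrightarrow> peval (bar_monomial \<eta>) (\<lambda>i. - bar \<gamma> i) = 0"
    and "csize \<gamma> = csize \<eta> \<Longrightarrow> lookup (bar_monomial \<eta>) \<gamma> = lookup (monomial \<eta>) \<gamma>"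
proof -
  have hom: "csize m = csize \<eta>" if "m \<in> keys (subst_neg (monomial \<eta>))" for m
    using that by (auto simp: in_keys_iff lookup_monomial split: if_splits)
  note l = interp_lift_homogeneous[of "subst_neg (monomial \<eta>)" "csize \<eta>", OF hom]
  have eq: "bar_monomial \<eta> = subst_neg (interp_lift (subst_neg (monomial \<eta>)))"
    by (simp add: bar_monomial_def Xi_eq)
  show "m \<in> keys (bar_monomial \<eta>) \<Longrightarrow> csize m \<le> csize \<eta>"
    using l(1) by (simp add: eq)
  show "csize \<gamma> < csize \<eta> \<Longrightarrow> peval (bar_monomial \<eta>) (\<lambda>i. - bar \<gamma> i) = 0"
    using l(2) by (simp add: eq peval_subst_neg)
  show "csize \<gamma> = csize \<eta> \<Longrightarrow> lookup (bar_monomial \<eta>) \<gamma> = lookup (monomial \<eta>) \<gamma>"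
    using l(3) by (simp add: eq lookup_subst_neg mult.assoc[symmetric] power_add[symmetric])
qed

theorem theorem3p11:
  fixes \<eta> :: "('n::{finite,linorder}) composition"
    and g :: "'n mpolynomial"
  shows "(tdegree (g - monomial \<eta>) < int (csize \<eta>) \<and>
          (\<forall>\<gamma>. csize \<gamma> < csize \<eta> \<longrightarrow> peval g (\<lambda>i. - bar \<gamma> i) = 0))
         \<longleftrightarrow> g = bar_monomial \<eta>"
proof
  assume "g = bar_monomial \<eta>"
  moreover have "csize m < csize \<eta>" if "m \<in> keys (bar_monomial \<eta> - monomial \<eta>)" for m
  proof -
    have "m \<in> keys (bar_monomial \<eta>) \<or> m \<in> keys (monomial \<eta>)"
      using that by (auto simp: in_keys_iff lookup_minus)
    then have "csize m \<le> csize \<eta>"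
      using bar_monomial(1) by (auto simp: monomial_def)
    \<comment> \<open>In size \<open>csize \<eta>\<close> the coefficients of the bar monomial and
      of x^\<eta> cancel.\<close>
    moreover have "csize m \<noteq> csize \<eta>"
      using that bar_monomial(3)[of m \<eta>] by (auto simp: in_keys_iff lookup_minus)
    ultimately show ?thesis by simp
  qed
  ultimately show "tdegree (g - monomial \<eta>) < int (csize \<eta>) \<and>
      (\<forall>\<gamma>. csize \<gamma> < csize \<eta> \<longrightarrow> peval g (\<lambda>i. - bar \<gamma> i) = 0)"
    by (simp add: tdegree_less_iff bar_monomial(2))
next
  assume g: "tdegree (g - monomial \<eta>) < int (csize \<eta>) \<and>
      (\<forall>\<gamma>. csize \<gamma> < csize \<eta> \<longrightarrow> peval g (\<lambda>i. - bar \<gamma> i) = 0)"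
  \<comment> \<open>The degree condition fixes every coefficient of \<open>g\<close> of size at
    least \<open>csize \<eta>\<close>; in particular none survives above that size.\<close>
  have top: "lookup g m = lookup (monomial \<eta>) m" if "csize m \<ge> csize \<eta>" for m
  proof -
    have "m \<notin> keys (g - monomial \<eta>)" using g that by (auto simp: tdegree_less_iff)
    then show ?thesis by (simp add: in_keys_iff lookup_minus)
  qed
  \<comment> \<open>Substituting -x moves the nodes to \<open>bar \<gamma>\<close>, where top
    coefficients together with lower values determine a polynomial.\<close>
  have "subst_neg g = subst_neg (bar_monomial \<eta>)"
  proof (rule interp_eqI[where d = "csize \<eta>"])
    show "csize m \<le> csize \<eta>" if "m \<in> keys (subst_neg g)" for m
      using that top[of m] by (force simp: in_keys_iff lookup_monomial split: if_splits)
    show "csize m \<le> csize \<eta>" if "m \<in> keys (subst_neg (bar_monomial \<eta>))" for m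
      using that bar_monomial(1) by auto
    show "peval (subst_neg g) (bar \<gamma>) = peval (subst_neg (bar_monomial \<eta>)) (bar \<gamma>)"
      if "csize \<gamma> < csize \<eta>" for \<gamma>
      using that g by (simp add: peval_subst_neg bar_monomial(2))
    show "lookup (subst_neg g) \<gamma> = lookup (subst_neg (bar_monomial \<eta>)) \<gamma> \<or>
        peval (subst_neg g) (bar \<gamma>) = peval (subst_neg (bar_monomial \<eta>)) (bar \<gamma>)"
      if "csize \<gamma> = csize \<eta>" for \<gamma>
      using that by (simp add: lookup_subst_neg top bar_monomial(3))
  qed
  then show "g = bar_monomial \<eta>"
    by (metis subst_neg_subst_neg)
qed

end
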